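(* Let $E$ be the edge set of a finite graph. For every $e\in E$ let $\Omega_1(e)=\Omega_2(e)=\{000,001,010,011,100,101,110,111\}$. Let $\mu_1=\frac23\mu_{11}+\frac13\mu_{12}$, where $\mu_{11}$ is uniform on $\{000,111\}$ and $\mu_{12}$ is uniform on $\Omega_1(e)$. Let $\mu_2=\frac13\mu_{21}+\frac13\mu_{22}+\frac13\mu_{23}$, where $\mu_{21}$ is uniform on $\{000,011,100,111\}$, $\mu_{22}$ is uniform on $\{000,010,101,111\}$ and $\mu_{23}$ is uniform on $\{000,001,110,111\}$. Let $C$ be the random configuration built by an arbitrary generating decision tree, $C_1$ the one built by a generating decision tree all of whose decisions are $1$, and $C_2$ the one built by a generating decision tree all of whose decisions are $2$. Let $\mathcal U,\mathcal V,\mathcal W\subseteq\{0,1\}^E$ be closed upward. Then $$\mathbf{P}(C_1\in\mathcal U\times\mathcal V\times\mathcal W)\ge\mathbf{P}(C\in\mathcal U\times\mathcal V\times\mathcal W)\ge\mathbf{P}(C_2\in\mathcal U\times\mathcal V\times\mathcal W).$$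
   Context: A set $\mathcal U\subseteq\{0,1\}^E$ is closed upward if $x\in\mathcal U$ and $x\le y$ coordinatewise imply $y\in\mathcal U$. A generating decision tree is a finite rooted tree in which each node $N$ carries an edge $e(N)\in E$ and a decision $D(N)\in\{1,2\}$. When a node $N$ with $D(N)=i$ is visited, a random element of $\Omega_i(e(N))$ is generated according to $\mu_i$ (independently of everything generated before) and assigned to the edge $e(N)$; if $N$ is not a leaf, it has children indexed by the elements of $\Omega_i(e(N))$, and one moves to the child indexed by the generated element. Every path from the root to a leaf contains each edge of $E$ exactly once. Thus a run from the root produces a random configuration assigning to each edge a triplet of binary digits; $\mathbf{P}$ is the induced distribution. For such a configuration, let $E_1,E_2,E_3\in\{0,1\}^E$ be formed by the first, second and third digits, respectively, of the triplets on the edges. The configuration belongs to $\mathcal U\times\mathcal V\times\mathcal W$ if $E_1\in\mathcal U$, $E_2\in\mathcal V$ and $E_3\in\mathcal W$. *)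

theory Defs
  imports "HOL-Probability.Probability"
begin

text \<open>Loops and multiple edges are allowed: \<open>ends e\<close> is the set of endpoints of \<open>e\<close>.\<close>

definition finite_graph :: "'v set \<Rightarrow> 'e set \<Rightarrow> ('e \<Rightarrow> 'v set) \<Rightarrow> bool" where
  "finite_graph V E ends \<longleftrightarrow>
     finite V \<and> finite E \<and> (\<forall>e\<in>E. ends e \<subseteq> V \<and> card (ends e) \<in> {1, 2})"

text \<open>Binary digits are Booleans, with \<open>False\<close> for 0 and \<open>True\<close> for 1. As
  \<open>\<Omega>\<^sub>1(e) = \<Omega>\<^sub>2(e)\<close> is the set of all eight triplets for every edge, it is
  the whole type \<open>triplet\<close>.\<close>

type_synonym triplet = "bool \<times> bool \<times> bool"

definition mu11 :: "triplet pmf" where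
  "mu11 = pmf_of_set {(False, False, False), (True, True, True)}"

definition mu12 :: "triplet pmf" where
  "mu12 = pmf_of_set UNIV"

definition mu1 :: "triplet pmf" where
  "mu1 = bind_pmf (bernoulli_pmf (2 / 3)) (\<lambda>b. if b then mu11 else mu12)"

definition mu21 :: "triplet pmf" where
  "mu21 = pmf_of_set
     {(False, False, False), (False, True, True), (True, False, False), (True, True, True)}"

definition mu22 :: "triplet pmf" where
  "mu22 = pmf_of_set
     {(False, False, False), (False, True, False), (True, False, True), (True, True, True)}"

definition mu23 :: "triplet pmf" where
  "mu23 = pmf_of_set
     {(False, False, False), (False, False, True), (True, True, False), (True, True, True)}"

definition mu2 :: "triplet pmf" where
  "mu2 = bind_pmf (pmf_of_set {1, 2, 3 :: nat})
     (\<lambda>k. if k = 1 then mu21 else if k = 2 then mu22 else mu23)"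

lemma pmf_mu1: "pmf mu1 x = 2 / 3 * pmf mu11 x + 1 / 3 * pmf mu12 x"
  by (simp add: mu1_def pmf_bind)

lemma pmf_mu2: "pmf mu2 x = 1 / 3 * pmf mu21 x + 1 / 3 * pmf mu22 x + 1 / 3 * pmf mu23 x"
  by (simp add: mu2_def pmf_bind integral_pmf_of_set field_simps)

datatype decision = D1 | D2

fun mu :: "decision \<Rightarrow> triplet pmf" where
  "mu D1 = mu1"
| "mu D2 = mu2"

text \<open>Leaves are nodes too: they carry an edge and a decision, and a triplet is generated
  there as well. The branching type is finite, so every such tree is finite.\<close>

datatype 'e tree =
    Leaf 'e decision
  | Node 'e decision "triplet \<Rightarrow> 'e tree"

primrec root_leaf_paths :: "'e tree \<Rightarrow> 'e list set" where
  "root_leaf_paths (Leaf e d) = {[e]}"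
| "root_leaf_paths (Node e d ch) = (\<Union>x. (#) e ` root_leaf_paths (ch x))"

primrec decisions :: "'e tree \<Rightarrow> decision set" where
  "decisions (Leaf e d) = {d}"
| "decisions (Node e d ch) = insert d (\<Union>x. decisions (ch x))"

definition generating_decision_tree :: "'e set \<Rightarrow> 'e tree \<Rightarrow> bool" where
  "generating_decision_tree E t \<longleftrightarrow> (\<forall>p\<in>root_leaf_paths t. distinct p \<and> set p = E)"

text \<open>The law of the configuration built by a run from the root. For a generating decision
  tree on \<open>E\<close> it is supported on \<open>E \<rightarrow>\<^sub>E UNIV\<close>.\<close>

primrec run :: "'e tree \<Rightarrow> ('e \<Rightarrow> triplet) pmf" where
  "run (Leaf e d) = map_pmf (\<lambda>x. (\<lambda>_. undefined)(e := x)) (mu d)"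
| "run (Node e d ch) = bind_pmf (mu d) (\<lambda>x. map_pmf (\<lambda>c. c(e := x)) (run (ch x)))"

text \<open>The set \<open>{0,1}\<^sup>E\<close> is \<open>E \<rightarrow>\<^sub>E UNIV\<close>, whose members are \<open>undefined\<close> off \<open>E\<close>.\<close>

definition closed_upward :: "'e set \<Rightarrow> ('e \<Rightarrow> bool) set \<Rightarrow> bool" where
  "closed_upward E U \<longleftrightarrow>
     (\<forall>x\<in>U. \<forall>y \<in> E \<rightarrow>\<^sub>E UNIV. (\<forall>e\<in>E. x e \<le> y e) \<longrightarrow> y \<in> U)"

definition digits1 :: "'e set \<Rightarrow> ('e \<Rightarrow> triplet) \<Rightarrow> 'e \<Rightarrow> bool" where
  "digits1 E c = (\<lambda>e\<in>E. case c e of (a, b, d) \<Rightarrow> a)"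

definition digits2 :: "'e set \<Rightarrow> ('e \<Rightarrow> triplet) \<Rightarrow> 'e \<Rightarrow> bool" where
  "digits2 E c = (\<lambda>e\<in>E. case c e of (a, b, d) \<Rightarrow> b)"

definition digits3 :: "'e set \<Rightarrow> ('e \<Rightarrow> triplet) \<Rightarrow> 'e \<Rightarrow> bool" where
  "digits3 E c = (\<lambda>e\<in>E. case c e of (a, b, d) \<Rightarrow> d)"

definition product_event ::
    "'e set \<Rightarrow> ('e \<Rightarrow> bool) set \<Rightarrow> ('e \<Rightarrow> bool) set \<Rightarrow> ('e \<Rightarrow> bool) set \<Rightarrow> ('e \<Rightarrow> triplet) set" where
  "product_event E U V W = {c. digits1 E c \<in> U \<and> digits2 E c \<in> V \<and> digits3 E c \<in> W}"

end

theory Submission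
  imports Defs
begin

text \<open>
  Every digit is fair under both \<open>mu1\<close> and \<open>mu2\<close>, but the three digits of a triplet are more
  strongly correlated under \<open>mu1\<close>. On a single edge this says that a product of three upward
  closed events in \<open>{0,1}\<close> is at least as likely under \<open>mu1\<close> as under \<open>mu2\<close>
  (\<open>mu2_le_mu1_product\<close>).

  The class of products of three upward closed events is stable under fixing the triplet on
  one edge, and equally under fixing all triplets but one. So if one edge is independent of the
  others, then conditioning on the others shows that changing the law on that edge from \<open>mu2\<close> to
  \<open>mu1\<close> does not decrease the probability of any event in the class
  (\<open>product_le_edge\<close>).

  This gives the theorem by induction on the tree. A tree all of whose decisions are \<open>d\<close> builds
  the product measure with all factors \<open>mu d\<close>, whatever the order in which it visits the edges
  (\<open>run_constant_decision\<close>). In an arbitrary tree, the law of the root triplet is fixed, and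
  given that triplet the subtree can be compared by the induction hypothesis with the product
  measure on the remaining edges. After this replacement the remaining edges no longer depend on
  the root triplet, so the root decision too may be replaced by 1 or 2. Adaptivity therefore
  gains nothing (\<open>run_between_products\<close>).
\<close>

section \<open>One edge\<close>

lemma pmf_mu1_cases:
  "pmf mu1 x = (if x = (False, False, False) \<or> x = (True, True, True) then 3 / 8 else 1 / 24)"
  by (simp add: pmf_mu1 mu11_def mu12_def)

lemma pmf_mu2_cases:
  "pmf mu2 x = (if x = (False, False, False) \<or> x = (True, True, True) then 1 / 4 else 1 / 12)"
  by (cases x) (auto simp: pmf_mu2 mu21_def mu22_def mu23_def indicator_def)

lemma prob_triplet_product:
  fixes p :: "triplet pmf"
  shows "measure_pmf.prob p {x. u (fst x) \<and> v (fst (snd x)) \<and> w (snd (snd x))} =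
    (\<Sum>a\<in>UNIV. \<Sum>b\<in>UNIV. \<Sum>c\<in>UNIV. if u a \<and> v b \<and> w c then pmf p (a, b, c) else 0)"
proof -
  have "measure_pmf.prob p {x. u (fst x) \<and> v (fst (snd x)) \<and> w (snd (snd x))} =
      (\<Sum>x\<in>UNIV. if u (fst x) \<and> v (fst (snd x)) \<and> w (snd (snd x)) then pmf p x else 0)"
    by (simp add: measure_measure_pmf_finite sum.If_cases)
  also have "\<dots> = (\<Sum>a\<in>UNIV. \<Sum>b\<in>UNIV. \<Sum>c\<in>UNIV. if u a \<and> v b \<and> w c then pmf p (a, b, c) else 0)"
    by (auto simp: sum.cartesian_product split_def intro!: sum.cong)
  finally show ?thesis .
qed

text \<open>Compared with \<open>mu2\<close>, the law \<open>mu1\<close> has \<open>1/8\<close> more mass on each of the two constant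
  triplets and \<open>1/24\<close> less on each of the six others. Each of the three factors of the event is
  \<open>{}\<close>, \<open>{1}\<close> or \<open>{0,1}\<close>. If one is empty, or if all are full, there is equality. Otherwise the
  event contains \<open>111\<close>, and some factor is \<open>{1}\<close>, so it contains at most three other triplets.\<close>

lemma mu2_le_mu1_product:
  fixes u v w :: "bool \<Rightarrow> bool"
  assumes "mono u" "mono v" "mono w"
  shows "measure_pmf.prob mu2 {x. u (fst x) \<and> v (fst (snd x)) \<and> w (snd (snd x))}
    \<le> measure_pmf.prob mu1 {x. u (fst x) \<and> v (fst (snd x)) \<and> w (snd (snd x))}"
proof -
  have "u False \<longrightarrow> u True" "v False \<longrightarrow> v True" "w False \<longrightarrow> w True"
    using assms[THEN monoD, of False True] by auto
  then show ?thesis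
    unfolding prob_triplet_product
    by (cases "u True"; cases "u False"; cases "v True"; cases "v False";
        cases "w True"; cases "w False")
      (simp_all add: UNIV_bool pmf_mu1_cases pmf_mu2_cases)
qed


section \<open>Products of upward closed events\<close>

text \<open>Membership is tested on all total functions, with no reference to the edge set, so that
  sections along an edge stay in the same class.\<close>

definition product_upsets :: "('e \<Rightarrow> triplet) set set" where
  "product_upsets = {{c. u (\<lambda>i. fst (c i)) \<and> v (\<lambda>i. fst (snd (c i))) \<and> w (\<lambda>i. snd (snd (c i)))}
     | u v w. mono u \<and> mono v \<and> mono w}"

definition product_le :: "('e \<Rightarrow> triplet) pmf \<Rightarrow> ('e \<Rightarrow> triplet) pmf \<Rightarrow> bool" (infix "\<preceq>" 50) where
  "p \<preceq> q \<longleftrightarrow> (\<forall>A\<in>product_upsets. measure_pmf.prob p A \<le> measure_pmf.prob q A)"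

lemma product_le_refl: "p \<preceq> p"
  by (simp add: product_le_def)

lemma product_le_trans [trans]: "p \<preceq> q \<Longrightarrow> q \<preceq> r \<Longrightarrow> p \<preceq> r"
  unfolding product_le_def by (meson order_trans)

lemma digits_fun_upd:
  "(\<lambda>i. fst ((c(e := x)) i)) = (\<lambda>i. fst (c i))(e := fst x)"
  "(\<lambda>i. fst (snd ((c(e := x)) i))) = (\<lambda>i. fst (snd (c i)))(e := fst (snd x))"
  "(\<lambda>i. snd (snd ((c(e := x)) i))) = (\<lambda>i. snd (snd (c i)))(e := snd (snd x))"
  by auto

lemma mono_compose_fun_upd:
  fixes u :: "('e \<Rightarrow> bool) \<Rightarrow> bool"
  assumes "mono u"
  shows "mono (\<lambda>f. u (f(e := a)))" and "mono (\<lambda>a. u (f(e := a)))"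
  by (rule monoI, rule monoD[OF assms], simp add: le_fun_def)+

lemma product_upsets_section:
  assumes "A \<in> product_upsets"
  shows "{c. c(e := x) \<in> A} \<in> product_upsets"
proof -
  obtain u v w where m: "mono u" "mono v" "mono w"
    and A: "A = {c. u (\<lambda>i. fst (c i)) \<and> v (\<lambda>i. fst (snd (c i))) \<and> w (\<lambda>i. snd (snd (c i)))}"
    using assms unfolding product_upsets_def by blast
  have "{c. c(e := x) \<in> A} = {c. u ((\<lambda>i. fst (c i))(e := fst x)) \<and>
      v ((\<lambda>i. fst (snd (c i)))(e := fst (snd x))) \<and> w ((\<lambda>i. snd (snd (c i)))(e := snd (snd x)))}"
    unfolding A mem_Collect_eq digits_fun_upd ..
  then show ?thesis
    unfolding product_upsets_def mem_Collect_eq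
    by (intro exI conjI) (assumption | rule m[THEN mono_compose_fun_upd(1)])+
qed

lemma mu2_le_mu1_section:
  assumes "A \<in> product_upsets"
  shows "measure_pmf.prob mu2 {x. c(e := x) \<in> A} \<le> measure_pmf.prob mu1 {x. c(e := x) \<in> A}"
proof -
  obtain u v w where m: "mono u" "mono v" "mono w"
    and A: "A = {c. u (\<lambda>i. fst (c i)) \<and> v (\<lambda>i. fst (snd (c i))) \<and> w (\<lambda>i. snd (snd (c i)))}"
    using assms unfolding product_upsets_def by blast
  have "{x. c(e := x) \<in> A} = {x. u ((\<lambda>i. fst (c i))(e := fst x)) \<and>
      v ((\<lambda>i. fst (snd (c i)))(e := fst (snd x))) \<and> w ((\<lambda>i. snd (snd (c i)))(e := snd (snd x)))}"
    unfolding A mem_Collect_eq digits_fun_upd ..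
  then show ?thesis
    using mu2_le_mu1_product[OF m[THEN mono_compose_fun_upd(2)]] by simp
qed

lemma product_le_bind:
  fixes f g :: "'a \<Rightarrow> ('e \<Rightarrow> triplet) pmf"
  assumes "\<And>x. x \<in> set_pmf p \<Longrightarrow> f x \<preceq> g x"
  shows "bind_pmf p f \<preceq> bind_pmf p g"
  unfolding product_le_def
proof
  fix A :: "('e \<Rightarrow> triplet) set"
  assume A: "A \<in> product_upsets"
  have expand: "measure_pmf.prob (bind_pmf p h) A
      = measure_pmf.expectation p (\<lambda>x. measure_pmf.prob (h x) A)"
    for h :: "'a \<Rightarrow> ('e \<Rightarrow> triplet) pmf"
    by (simp add: bind_pmf.rep_eq measure_pmf.measure_bind[where N = "count_space UNIV"]
        measure_pmf_in_subprob_algebra)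
  have int: "integrable (measure_pmf p) (\<lambda>x. measure_pmf.prob (h x) A)"
    for h :: "'a \<Rightarrow> ('e \<Rightarrow> triplet) pmf"
    by (rule measure_pmf.integrable_const_bound[where B = 1]) auto
  show "measure_pmf.prob (bind_pmf p f) A \<le> measure_pmf.prob (bind_pmf p g) A"
    unfolding expand
    by (intro integral_mono_AE int)
      (use assms A in \<open>auto simp: product_le_def AE_measure_pmf_iff\<close>)
qed

lemma product_le_fun_upd:
  assumes "p \<preceq> q"
  shows "map_pmf (\<lambda>c. c(e := x)) p \<preceq> map_pmf (\<lambda>c. c(e := x)) q"
  using assms product_upsets_section[of _ e x]
  by (auto simp: product_le_def vimage_def)

text \<open>The edge \<open>e\<close> gets its triplet independently of \<open>q\<close>, so this triplet may be drawn last,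
  once the rest of the configuration is known.\<close>

lemma product_le_edge:
  "bind_pmf mu2 (\<lambda>x. map_pmf (\<lambda>c. c(e := x)) q) \<preceq> bind_pmf mu1 (\<lambda>x. map_pmf (\<lambda>c. c(e := x)) q)"
proof -
  have swap: "bind_pmf m (\<lambda>x. map_pmf (\<lambda>c. c(e := x)) q)
      = bind_pmf q (\<lambda>c. map_pmf (\<lambda>x. c(e := x)) m)" for m
    unfolding map_pmf_def by (rule bind_commute_pmf)
  show ?thesis
    unfolding swap
    by (rule product_le_bind)
      (use mu2_le_mu1_section in \<open>auto simp: product_le_def vimage_def\<close>)
qed

lemma product_le_edge_decision:
  "bind_pmf (mu D2) (\<lambda>x. map_pmf (\<lambda>c. c(e := x)) q) \<preceq> bind_pmf (mu d) (\<lambda>x. map_pmf (\<lambda>c. c(e := x)) q)"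
  "bind_pmf (mu d) (\<lambda>x. map_pmf (\<lambda>c. c(e := x)) q) \<preceq> bind_pmf (mu D1) (\<lambda>x. map_pmf (\<lambda>c. c(e := x)) q)"
  by (cases d; simp only: mu.simps product_le_edge product_le_refl)+


section \<open>Decision trees and product measures\<close>

lemma root_leaf_paths_nonempty: "root_leaf_paths t \<noteq> {}"
  by (induction t) auto

lemma generating_decision_tree_Leaf:
  "generating_decision_tree E (Leaf e d) \<longleftrightarrow> E = {e}"
  by (auto simp: generating_decision_tree_def)

lemma generating_decision_tree_Node:
  assumes "generating_decision_tree E (Node e d ch)"
  shows "e \<in> E" and "generating_decision_tree (E - {e}) (ch x)"
proof -
  have *: "e \<notin> set p \<and> distinct p \<and> insert e (set p) = E" if "p \<in> root_leaf_paths (ch x)" for p x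
  proof -
    have "e # p \<in> root_leaf_paths (Node e d ch)"
      unfolding root_leaf_paths.simps by (intro UN_I[of x] imageI that UNIV_I)
    then show ?thesis
      using assms unfolding generating_decision_tree_def by fastforce
  qed
  show "e \<in> E"
    using * root_leaf_paths_nonempty[of "ch x"] by blast
  show "generating_decision_tree (E - {e}) (ch x)"
    unfolding generating_decision_tree_def using * by blast
qed

lemma Pi_pmf_remove:
  assumes "finite E" "e \<in> E"
  shows "Pi_pmf E dflt (\<lambda>_. m)
    = bind_pmf m (\<lambda>x. map_pmf (\<lambda>c. c(e := x)) (Pi_pmf (E - {e}) dflt (\<lambda>_. m)))"
proof -
  have "Pi_pmf E dflt (\<lambda>_. m) = Pi_pmf (insert e (E - {e})) dflt (\<lambda>_. m)"
    using assms by (simp add: insert_absorb)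
  then show ?thesis
    using assms Pi_pmf_insert'[of "E - {e}" e dflt "\<lambda>_. m"] by (simp add: map_pmf_def)
qed

lemma run_constant_decision:
  assumes "finite E" "generating_decision_tree E t" "decisions t \<subseteq> {d}"
  shows "run t = Pi_pmf E undefined (\<lambda>_. mu d)"
  using assms
proof (induction t arbitrary: E)
  case (Leaf e d')
  then show ?case
    by (simp add: generating_decision_tree_Leaf Pi_pmf_singleton fun_upd_def)
next
  case (Node e d' ch)
  have "run (ch x) = Pi_pmf (E - {e}) undefined (\<lambda>_. mu d)" for x
  proof (rule Node.IH)
    show "decisions (ch x) \<subseteq> {d}"
      using Node.prems(3) by auto
  qed (use Node.prems generating_decision_tree_Node(2)[OF Node.prems(2)] in auto)
  moreover have "d' = d"
    using Node.prems(3) by simp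
  moreover have "e \<in> E"
    using Node.prems(2) by (rule generating_decision_tree_Node)
  ultimately show ?case
    using Pi_pmf_remove[OF \<open>finite E\<close> \<open>e \<in> E\<close>, of undefined "mu d"] by simp
qed

text \<open>After the subtrees have been replaced by one and the same product measure, the root
  triplet is independent of the other edges, and \<open>product_le_edge\<close> applies to the root.\<close>

lemma run_between_products:
  assumes "finite E" "generating_decision_tree E t"
  shows "Pi_pmf E undefined (\<lambda>_. mu D2) \<preceq> run t \<and> run t \<preceq> Pi_pmf E undefined (\<lambda>_. mu D1)"
  using assms
proof (induction t arbitrary: E)
  case (Leaf e d)
  then have E: "E = {e}"
    by (simp add: generating_decision_tree_Leaf)
  \<comment> \<open>A leaf is treated as a node above the empty configuration.\<close>
  have single: "map_pmf (\<lambda>x. (\<lambda>_. undefined)(e := x)) m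
      = bind_pmf m (\<lambda>x. map_pmf (\<lambda>c. c(e := x)) (return_pmf (\<lambda>_. undefined)))" for m :: "triplet pmf"
    by (simp add: map_pmf_def bind_return_pmf)
  have Pi: "Pi_pmf E undefined (\<lambda>_. m)
      = bind_pmf m (\<lambda>x. map_pmf (\<lambda>c. c(e := x)) (return_pmf (\<lambda>_. undefined)))" for m :: "triplet pmf"
    using Pi_pmf_remove[of E e undefined m] by (simp add: E)
  show ?case
    unfolding Pi run.simps single
    by (intro conjI product_le_edge_decision)
next
  case (Node e d ch)
  let ?rest = "\<lambda>d'. Pi_pmf (E - {e}) undefined (\<lambda>_. mu d')"
  let ?draw = "\<lambda>d q. bind_pmf (mu d) (\<lambda>x. map_pmf (\<lambda>c. c(e := x)) q)"
  have IH: "?rest D2 \<preceq> run (ch x)" "run (ch x) \<preceq> ?rest D1" for x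
    using Node.IH[of "ch x" "E - {e}"] Node.prems
      generating_decision_tree_Node(2)[OF Node.prems(2)] by auto
  have Pi: "Pi_pmf E undefined (\<lambda>_. mu d') = ?draw d' (?rest d')" for d'
    using Node.prems generating_decision_tree_Node(1) by (intro Pi_pmf_remove) auto
  have "?draw D2 (?rest D2) \<preceq> ?draw d (?rest D2)"
    by (rule product_le_edge_decision)
  also have "?draw d (?rest D2) \<preceq> run (Node e d ch)"
    unfolding run.simps by (intro product_le_bind product_le_fun_upd IH)
  finally have lower: "?draw D2 (?rest D2) \<preceq> run (Node e d ch)" .
  have "run (Node e d ch) \<preceq> ?draw d (?rest D1)"
    unfolding run.simps by (intro product_le_bind product_le_fun_upd IH)
  also have "?draw d (?rest D1) \<preceq> ?draw D1 (?rest D1)"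
    by (rule product_le_edge_decision)
  finally show ?case
    using lower unfolding Pi by blast
qed


section \<open>The comparison\<close>

lemma mono_restrict_closed_upward:
  assumes "closed_upward E U"
  shows "mono (\<lambda>f. restrict f E \<in> U)"
proof (rule monoI, rule le_boolI)
  fix f g :: "'a \<Rightarrow> bool"
  assume "f \<le> g" "restrict f E \<in> U"
  moreover have "restrict g E \<in> E \<rightarrow>\<^sub>E UNIV"
    by simp
  ultimately show "restrict g E \<in> U"
    using assms unfolding closed_upward_def by (fastforce simp: le_fun_def)
qed

lemma product_event_in_product_upsets:
  assumes "closed_upward E U" "closed_upward E V" "closed_upward E W"
  shows "product_event E U V W \<in> product_upsets"
proof -
  have "product_event E U V W = {c. restrict (\<lambda>i. fst (c i)) E \<in> U \<and>
      restrict (\<lambda>i. fst (snd (c i))) E \<in> V \<and> restrict (\<lambda>i. snd (snd (c i))) E \<in> W}"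
    by (simp add: product_event_def digits1_def digits2_def digits3_def split_def)
  then show ?thesis
    unfolding product_upsets_def mem_Collect_eq
    by (intro exI conjI) (assumption | rule assms[THEN mono_restrict_closed_upward])+
qed

theorem theorem8p7:
  fixes Vert :: "'v set" and E :: "'e set" and ends :: "'e \<Rightarrow> 'v set"
    and t t1 t2 :: "'e tree"
    and U V W :: "('e \<Rightarrow> bool) set"
  assumes "finite_graph Vert E ends"
    and "generating_decision_tree E t"
    and "generating_decision_tree E t1" and "decisions t1 \<subseteq> {D1}"
    and "generating_decision_tree E t2" and "decisions t2 \<subseteq> {D2}"
    and "U \<subseteq> E \<rightarrow>\<^sub>E UNIV" and "closed_upward E U"
    and "V \<subseteq> E \<rightarrow>\<^sub>E UNIV" and "closed_upward E V"
    and "W \<subseteq> E \<rightarrow>\<^sub>E UNIV" and "closed_upward E W"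
  shows "measure_pmf.prob (run t1) (product_event E U V W)
           \<ge> measure_pmf.prob (run t) (product_event E U V W)
       \<and> measure_pmf.prob (run t) (product_event E U V W)
           \<ge> measure_pmf.prob (run t2) (product_event E U V W)"
proof -
  have "finite E"
    using assms(1) by (simp add: finite_graph_def)
  then have "run t2 \<preceq> run t \<and> run t \<preceq> run t1"
    using run_between_products[of E t] run_constant_decision[of E t1 D1]
      run_constant_decision[of E t2 D2] assms by simp
  then show ?thesis
    using product_event_in_product_upsets[of E U V W] assms by (simp add: product_le_def)
qed

end
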